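(* For every integer $l\ge 2$, $$(1+o(1))\left(\frac{m}{2l+1}\right)^{(2l+1)/2}\le \rho(C_{2l+1},m)\le \frac{(2l+1)^{l-1/2}}{2\,(l-1)^{(l-1)(2l+1)/(2l)}}\left(\frac{m}{2l+1}\right)^{(2l+1)/2},$$ where the upper bound holds for every positive integer $m$, and in the lower bound $o(1)$ denotes a quantity tending to $0$ as $m\to\infty$ with $l$ fixed.
   Context: Graphs are finite, simple and undirected. $C_k$ denotes the cycle on $k$ vertices. For graphs $G$ and $H$, $c(G,H)$ is the number of induced copies of $H$ in $G$, i.e. the number of subsets $S\subseteq V(G)$ such that the induced subgraph $G[S]$ is isomorphic to $H$. For a positive integer $m$, $\rho(H,m)=\max\{c(G,H) : G \text{ a graph with } |E(G)|=m\}$ (the number of vertices of $G$ is not restricted). *)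

theory Defs
  imports Complex_Main
begin

type_synonym 'a graph = "'a set \<times> 'a set set"

abbreviation verts :: "'a graph \<Rightarrow> 'a set" where "verts \<equiv> fst"
abbreviation edges :: "'a graph \<Rightarrow> 'a set set" where "edges \<equiv> snd"

definition simple_graph :: "'a graph \<Rightarrow> bool" where
  "simple_graph G \<longleftrightarrow> finite (verts G) \<and> (\<forall>e\<in>edges G. e \<subseteq> verts G \<and> card e = 2)"

definition induced :: "'a graph \<Rightarrow> 'a set \<Rightarrow> 'a graph" where
  "induced G S = (S, {e \<in> edges G. e \<subseteq> S})"

definition graph_iso :: "'a graph \<Rightarrow> 'b graph \<Rightarrow> bool" where
  "graph_iso G H \<longleftrightarrow>
     (\<exists>f. bij_betw f (verts G) (verts H) \<and>
          (\<forall>u\<in>verts G. \<forall>v\<in>verts G. {u, v} \<in> edges G \<longleftrightarrow> {f u, f v} \<in> edges H))"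

definition induced_copies :: "'a graph \<Rightarrow> 'b graph \<Rightarrow> nat" where
  "induced_copies G H = card {S. S \<subseteq> verts G \<and> graph_iso (induced G S) H}"

text \<open>
  Every finite graph is isomorphic to one whose vertices are natural numbers, so letting \<open>G\<close>
  range over graphs on subsets of \<^typ>\<open>nat\<close> loses nothing.  The set below is nonempty, and it is
  finite (so that \<open>Max\<close> is the true maximum) when \<open>H\<close> has no isolated vertices, since induced
  copies of such an \<open>H\<close> use only the at most \<open>2 * m\<close> non-isolated vertices of \<open>G\<close>.  If \<open>H\<close> has
  isolated vertices, the maximum need not exist.
\<close>
definition rho :: "'b graph \<Rightarrow> nat \<Rightarrow> nat" where
  "rho H m = Max {induced_copies G H | G :: nat graph. simple_graph G \<and> card (edges G) = m}"

text \<open>This is the cycle on \<open>k\<close> vertices only for \<open>k \<ge> 3\<close>.\<close>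
definition cycle_graph :: "nat \<Rightarrow> nat graph" where
  "cycle_graph k = ({..<k}, {{i, Suc i mod k} | i. i < k})"

end

theory Submission
  imports Defs "HOL-Analysis.Convex"
begin

text \<open>
  Upper bound. Let \<open>A\<close> be the set of labelled induced cycles of length \<open>k = 2 * l + 1\<close>; every induced
  copy accounts for \<open>2 * k\<close> of them. By Loomis--Whitney, \<open>card A ^ (k - 1)\<close> is at most the product
  of the sizes of the \<open>k\<close> projections of \<open>A\<close> that forget one vertex. Forgetting a vertex leaves an
  induced path on \<open>2 * l\<close> vertices, which is determined by the sequence of the \<open>l\<close> edges of its
  perfect matching. Such a sequence is an induced path in the auxiliary graph whose vertices are the
  \<open>m\<close> edges, two of them being adjacent if some edge joins them. An induced path is chosen step by
  step from neighbourhoods that become unavailable afterwards, so by AM-GM there are at most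
  \<open>m * (m / (l - 1)) ^ (l - 1)\<close> of them.

  Lower bound. A blow-up of the cycle with parts of size \<open>t = \<lfloor>sqrt (m / k)\<rfloor>\<close> has \<open>k * t\<^sup>2\<close> edges,
  and each of its \<open>t ^ k\<close> transversals induces a cycle.
\<close>

section \<open>The Loomis--Whitney inequality\<close>

text \<open>On \<open>A\<close> the map \<open>\<pi>\<close> factors through \<open>\<phi>\<close>,
  by way of a chosen preimage. This compares projections without naming the connecting map.\<close>

lemma card_image_le_if_determined:
  assumes "finite A" "\<And>f g. f \<in> A \<Longrightarrow> g \<in> A \<Longrightarrow> \<phi> f = \<phi> g \<Longrightarrow> \<pi> f = \<pi> g"
  shows "card (\<pi> ` A) \<le> card (\<phi> ` A)"
proof -
  have "\<pi> f = \<pi> (inv_into A \<phi> (\<phi> f))" if "f \<in> A" for f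
    using that by (intro assms(2)) (auto simp: inv_into_into f_inv_into_f)
  then have "\<pi> ` A \<subseteq> (\<lambda>y. \<pi> (inv_into A \<phi> y)) ` (\<phi> ` A)"
    by blast
  then show ?thesis
    using assms(1) by (meson card_image_le card_mono finite_imageI order_trans)
qed

lemma restrict_eq_iff: "restrict f K = restrict g K \<longleftrightarrow> (\<forall>i\<in>K. f i = g i)"
  by (auto simp: restrict_def fun_eq_iff)

section \<open>Power forms of the AM-GM and Hoelder inequalities\<close>

lemma prod_le_mean_power:
  fixes x :: "'i \<Rightarrow> real"
  assumes "finite I" "\<And>i. i \<in> I \<Longrightarrow> x i \<ge> 0"
  shows "(\<Prod>i\<in>I. x i) \<le> ((\<Sum>i\<in>I. x i) / card I) ^ card I"
proof (cases "I = {}")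
  case False
  then have n: "card I > 0"
    using assms by (simp add: card_gt_0_iff)
  have P: "(\<Prod>i\<in>I. x i) \<ge> 0"
    using assms by (intro prod_nonneg) auto
  have "((\<Prod>i\<in>I. x i) powr (1 / card I)) ^ card I \<le> (\<Sum>i\<in>I. x i / card I) ^ card I"
    using assms False by (intro power_mono arith_geom_mean) auto
  moreover have "((\<Prod>i\<in>I. x i) powr (1 / card I)) ^ card I = (\<Prod>i\<in>I. x i)"
    using n P by (simp add: root_powr_inverse[symmetric])
  ultimately show ?thesis
    by (simp add: sum_divide_distrib)
qed simp

text \<open>A form of the generalized Hoelder inequality that avoids fractional exponents.\<close>

lemma prod_sum_power_bound:
  fixes c :: "'x \<Rightarrow> real" and a :: "'i \<Rightarrow> 'x \<Rightarrow> real"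
  assumes I: "finite I" "I \<noteq> {}" and X: "finite X" and K: "K \<ge> 0"
    and c: "\<And>x. x \<in> X \<Longrightarrow> c x \<ge> 0"
    and a: "\<And>i x. i \<in> I \<Longrightarrow> x \<in> X \<Longrightarrow> a i x \<ge> 0"
    and le: "\<And>x. x \<in> X \<Longrightarrow> c x ^ card I \<le> K * (\<Prod>i\<in>I. a i x)"
  shows "(\<Sum>x\<in>X. c x) ^ card I \<le> K * (\<Prod>i\<in>I. \<Sum>x\<in>X. a i x)"
proof -
  define S where "S i = (\<Sum>x\<in>X. a i x)" for i
  define M where "M = K * (\<Prod>i\<in>I. S i)"
  have n: "card I > 0"
    using I by (simp add: card_gt_0_iff)
  have S0: "S i \<ge> 0" if "i \<in> I" for i
    unfolding S_def using a that by (intro sum_nonneg) auto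
  have M0: "M \<ge> 0"
    unfolding M_def using K S0 by (intro mult_nonneg_nonneg prod_nonneg) auto
  show ?thesis
  proof (cases "M = 0")
    case True
    \<comment> \<open>Each \<open>a i x\<close> is at most its sum \<open>S i\<close>, so the bound
      on \<open>c x ^ card I\<close> is at most \<open>M = 0\<close>.\<close>
    have "c x = 0" if x: "x \<in> X" for x
    proof -
      have "a i x \<le> S i" if "i \<in> I" for i
        unfolding S_def using a that x X by (intro member_le_sum) auto
      then have "(\<Prod>i\<in>I. a i x) \<le> (\<Prod>i\<in>I. S i)"
        using a x by (intro prod_mono) auto
      then have "K * (\<Prod>i\<in>I. a i x) \<le> M"
        unfolding M_def using K by (rule mult_left_mono)
      with le[OF x] True have "c x ^ card I \<le> 0"
        by simp
      with c[OF x] n show ?thesis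
        by (metis zero_less_power less_eq_real_def not_less)
    qed
    then have "(\<Sum>x\<in>X. c x) ^ card I = 0"
      using n by simp
    then show ?thesis
      using M0 by (simp only: M_def S_def)
  next
    case False
    with M0 have Mpos: "M > 0"
      by simp
    have Spos: "S i > 0" if "i \<in> I" for i
      using False S0[OF that] that I unfolding M_def by (auto simp: less_le)
    define r where "r = root (card I) M"
    have r: "r > 0" "r ^ card I = M"
      using Mpos n by (auto simp: r_def)
    \<comment> \<open>AM-GM is applied to the normalised values \<open>a i x / S i\<close>. For
      every \<open>i\<close> they sum to 1 over \<open>X\<close>, so the bounds on the
      \<open>c x\<close> add up to \<open>r\<close>.\<close>
    have "c x \<le> r * (\<Sum>i\<in>I. a i x / S i / card I)" if x: "x \<in> X" for x
    proof -
      have "c x ^ card I \<le> M * (\<Prod>i\<in>I. a i x / S i)"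
        using le[OF x] False by (simp add: M_def prod_dividef)
      also have "\<dots> \<le> M * ((\<Sum>i\<in>I. a i x / S i) / card I) ^ card I"
        using Mpos I a[OF _ x] S0 by (intro mult_left_mono prod_le_mean_power) auto
      also have "\<dots> = (r * (\<Sum>i\<in>I. a i x / S i / card I)) ^ card I"
        by (simp add: power_mult_distrib r sum_divide_distrib)
      finally show ?thesis
        using r(1) a[OF _ x] S0 n
        by (subst (asm) power_mono_iff) (auto intro!: mult_nonneg_nonneg sum_nonneg c[OF x])
    qed
    then have "(\<Sum>x\<in>X. c x) \<le> (\<Sum>x\<in>X. r * (\<Sum>i\<in>I. a i x / S i / card I))"
      by (rule sum_mono)
    also have "\<dots> = r * (\<Sum>i\<in>I. (\<Sum>x\<in>X. a i x) / S i / card I)"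
      unfolding sum_distrib_left[symmetric] sum_divide_distrib
      by (rule arg_cong[where f = "(*) r"]) (rule sum.swap)
    also have "(\<Sum>i\<in>I. (\<Sum>x\<in>X. a i x) / S i / card I) = (\<Sum>i\<in>I. 1 / card I)"
      using Spos by (intro sum.cong) (auto simp: S_def[symmetric] less_imp_neq[symmetric])
    also have "r * \<dots> = r"
      using n by simp
    finally have "(\<Sum>x\<in>X. c x) ^ card I \<le> r ^ card I"
      using c by (intro power_mono sum_nonneg) auto
    then show ?thesis
      unfolding r by (simp add: M_def S_def)
  qed
qed

text \<open>AM-GM for \<open>a\<close> together with \<open>n\<close> copies of
  \<open>b / n\<close>. For \<open>n = 0\<close> the power is 1 and the claim reads
  \<open>a \<le> a + b\<close>.\<close>

lemma mult_power_mean_le: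
  fixes a b :: real
  assumes "a \<ge> 0" "b \<ge> 0"
  shows "a * (b / n) ^ n \<le> ((a + b) / Suc n) ^ Suc n"
proof (cases "n = 0")
  case False
  define x where "x i = (if i = 0 then a else b / n)" for i :: nat
  have "(\<Prod>i\<in>{..n}. x i) \<le> ((\<Sum>i\<in>{..n}. x i) / card {..n}) ^ card {..n}"
    by (rule prod_le_mean_power) (use assms in \<open>auto simp: x_def\<close>)
  moreover have "(\<Prod>i\<in>{..n}. x i) = a * (b / n) ^ n"
    by (subst prod.atMost_shift) (simp add: x_def)
  moreover have "(\<Sum>i\<in>{..n}. x i) = a + b"
    using False by (subst sum.atMost_shift) (simp add: x_def)
  ultimately show ?thesis by simp
qed (use assms in auto)

text \<open>Induction on the coordinates, slicing \<open>A\<close> by the value at the new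
  coordinate \<open>j\<close>. One factor of the size of a slice is bounded by the projection
  forgetting \<open>j\<close>, the remaining power by the induction hypothesis, and
  \<open>prod_sum_power_bound\<close> sums over the slices.\<close>

lemma loomis_whitney:
  fixes A :: "('i \<Rightarrow> 'x) set"
  assumes "finite I" "I \<noteq> {}" "finite A" "A \<noteq> {}" "A \<subseteq> extensional I"
  shows "real (card A) ^ (card I - 1) \<le> (\<Prod>i\<in>I. real (card ((\<lambda>f. restrict f (I - {i})) ` A)))"
  using assms
proof (induction I arbitrary: A rule: finite_ne_induct)
  case (singleton i)
  then show ?case by (simp add: restrict_def image_constant_conv)
next
  case (insert j I)
  let ?J = "insert j I"
  have jI: "j \<notin> I" by fact
  define X where "X = (\<lambda>f. f j) ` A"
  define s where "s x = {f \<in> A. f j = x}" for x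
  define B where "B x = (\<lambda>f. restrict f I) ` s x" for x
  have s0: "s x \<noteq> {}" if "x \<in> X" for x
    using that by (auto simp: X_def s_def)
  have [simp]: "finite X" "finite (s x)" for x
    using insert.prems by (auto simp: X_def s_def)
  \<comment> \<open>Coordinate \<open>j\<close> is constant on a slice, so forgetting it is
    injective there.\<close>
  have cB: "card (B x) = card (s x)" for x
    unfolding B_def
  proof (rule card_image, rule inj_onI)
    fix f g assume fg: "f \<in> s x" "g \<in> s x" "restrict f I = restrict g I"
    then have "f i = g i" if "i \<in> ?J" for i
      using that by (cases "i = j") (auto simp: s_def dest: fun_cong[of _ _ i])
    then show "f = g"
      using fg insert.prems by (intro extensionalityI[of f ?J g]) (auto simp: s_def)
  qed
  have cA: "real (card A) = (\<Sum>x\<in>X. real (card (s x)))"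
  proof -
    have "A = (\<Union>x\<in>X. s x)" by (auto simp: X_def s_def)
    then have "card A = card (\<Union>x\<in>X. s x)" by simp
    also have "\<dots> = (\<Sum>x\<in>X. card (s x))"
      by (rule card_UN_disjoint) (use insert.prems in \<open>auto simp: s_def\<close>)
    finally show ?thesis by simp
  qed
  define q where "q i x = (\<lambda>f. restrict f (I - {i})) ` B x" for i x
  have q_eq: "q i x = (\<lambda>f. restrict f (I - {i})) ` s x" for i x
    unfolding q_def B_def image_image by (intro image_cong) (auto simp: restrict_def)
  \<comment> \<open>Forgetting \<open>i\<close> keeps coordinate \<open>j\<close>, so the
    projections of distinct slices stay disjoint and their sizes add up.\<close>
  have sum_q: "(\<Sum>x\<in>X. real (card (q i x))) = real (card ((\<lambda>f. restrict f (?J - {i})) ` A))"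
    if i: "i \<in> I" for i
  proof -
    have ij: "i \<noteq> j" using i jI by auto
    have "card (q i x) = card ((\<lambda>f. restrict f (?J - {i})) ` s x)" for x
    proof (rule antisym)
      show "card (q i x) \<le> card ((\<lambda>f. restrict f (?J - {i})) ` s x)"
        unfolding q_eq using jI
        by (intro card_image_le_if_determined) (auto simp: restrict_eq_iff)
      show "card ((\<lambda>f. restrict f (?J - {i})) ` s x) \<le> card (q i x)"
        unfolding q_eq using ij
        by (intro card_image_le_if_determined) (use insert.prems in \<open>auto simp: restrict_eq_iff s_def\<close>)
    qed
    moreover have "card (\<Union>x\<in>X. (\<lambda>f. restrict f (?J - {i})) ` s x)
        = (\<Sum>x\<in>X. card ((\<lambda>f. restrict f (?J - {i})) ` s x))"
    proof (rule card_UN_disjoint, simp, simp, intro ballI impI)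
      fix x y assume "x \<in> X" "y \<in> X" "x \<noteq> y"
      then show "(\<lambda>f. restrict f (?J - {i})) ` s x \<inter> (\<lambda>f. restrict f (?J - {i})) ` s y = {}"
        using ij by (auto simp: s_def dest: fun_cong[of _ _ j])
    qed
    moreover have "(\<Union>x\<in>X. (\<lambda>f. restrict f (?J - {i})) ` s x) = (\<lambda>f. restrict f (?J - {i})) ` A"
      by (auto simp: X_def s_def)
    ultimately show ?thesis by simp
  qed
  define K where "K = real (card ((\<lambda>f. restrict f I) ` A))"
  have "(\<Sum>x\<in>X. real (card (s x))) ^ card I \<le> K * (\<Prod>i\<in>I. \<Sum>x\<in>X. real (card (q i x)))"
  proof (rule prod_sum_power_bound)
    fix x assume x: "x \<in> X"
    have "card I = Suc (card I - 1)"
      using insert.hyps by (simp add: card_gt_0_iff)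
    then have "real (card (s x)) ^ card I = real (card (B x)) * real (card (B x)) ^ (card I - 1)"
      unfolding cB by (metis power_Suc)
    also have "\<dots> \<le> K * (\<Prod>i\<in>I. real (card (q i x)))"
    proof (rule mult_mono)
      show "real (card (B x)) \<le> K"
        unfolding K_def B_def using insert.prems
        by (auto simp: s_def intro!: card_mono)
      show "real (card (B x)) ^ (card I - 1) \<le> (\<Prod>i\<in>I. real (card (q i x)))"
        unfolding q_def by (rule insert.IH) (use s0[OF x] in \<open>auto simp: B_def\<close>)
    qed (auto simp: K_def)
    finally show "real (card (s x)) ^ card I \<le> K * (\<Prod>i\<in>I. real (card (q i x)))" .
  qed (use insert.hyps in \<open>auto simp: K_def\<close>)
  also have "\<dots> = (\<Prod>i\<in>?J. real (card ((\<lambda>f. restrict f (?J - {i})) ` A)))"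
    using insert.hyps jI by (simp add: sum_q K_def)
  finally show ?case
    by (simp only: cA card_insert_disjoint[OF insert.hyps(1) jI] diff_Suc_1)
qed

section \<open>Counting induced paths\<close>

text \<open>
  The lists \<open>xs\<close> of length \<open>n\<close> over \<open>U\<close> such that in \<open>v # xs\<close> each entry is related by \<open>R\<close> to the
  next one and to no later one.
\<close>

primrec ipaths :: "('a \<Rightarrow> 'a \<Rightarrow> bool) \<Rightarrow> nat \<Rightarrow> 'a set \<Rightarrow> 'a \<Rightarrow> 'a list set" where
  "ipaths R 0 U v = {[]}"
| "ipaths R (Suc n) U v =
     (\<Union>x\<in>{x \<in> U. R v x}. (#) x ` ipaths R n {u \<in> U. \<not> R v u} x)"

lemma finite_ipaths: "finite U \<Longrightarrow> finite (ipaths R n U v)"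
  by (induction n arbitrary: U v) auto

text \<open>The first entry is a neighbour of \<open>v\<close> in \<open>U\<close>, and the later
  entries avoid all these neighbours. The two parts of \<open>U\<close> have sizes adding up to
  \<open>card U\<close>, so \<open>mult_power_mean_le\<close> closes the induction.\<close>

lemma card_ipaths_le:
  "finite U \<Longrightarrow> real (card (ipaths R n U v)) \<le> (real (card U) / n) ^ n"
proof (induction n arbitrary: U v)
  case (Suc n)
  let ?N = "{x \<in> U. R v x}" and ?W = "{x \<in> U. \<not> R v x}"
  have "real (card (ipaths R (Suc n) U v)) \<le> (\<Sum>x\<in>?N. real (card (ipaths R n ?W x)))"
  proof -
    have "card (ipaths R (Suc n) U v) \<le> (\<Sum>x\<in>?N. card ((#) x ` ipaths R n ?W x))"
      using Suc.prems by (simp add: card_UN_le)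
    also have "\<dots> = (\<Sum>x\<in>?N. card (ipaths R n ?W x))"
      by (intro sum.cong card_image) auto
    finally show ?thesis by (metis of_nat_le_iff of_nat_sum)
  qed
  also have "\<dots> \<le> (\<Sum>x\<in>?N. (real (card ?W) / n) ^ n)"
    using Suc.prems by (intro sum_mono Suc.IH) auto
  also have "\<dots> = real (card ?N) * (real (card ?W) / n) ^ n"
    by simp
  also have "\<dots> \<le> ((real (card ?N) + real (card ?W)) / Suc n) ^ Suc n"
    by (rule mult_power_mean_le) auto
  also have "real (card ?N) + real (card ?W) = real (card U)"
  proof -
    have "card (?N \<union> ?W) = card ?N + card ?W"
      using Suc.prems by (intro card_Un_disjoint) auto
    moreover have "?N \<union> ?W = U" by auto
    ultimately show ?thesis by simp
  qed
  finally show ?case .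
qed simp

text \<open>Turns conditions on an indexed sequence into membership in \<open>ipaths\<close>. When
  \<open>s\<close> advances, \<open>U\<close> loses the neighbours of \<open>e s\<close>; the third
  assumption keeps the later entries inside.\<close>

lemma map_upt_in_ipaths:
  assumes "\<And>t. s < t \<Longrightarrow> t \<le> s + n \<Longrightarrow> e t \<in> U"
    and "\<And>t. s \<le> t \<Longrightarrow> t < s + n \<Longrightarrow> R (e t) (e (Suc t))"
    and "\<And>t t'. s \<le> t \<Longrightarrow> Suc t < t' \<Longrightarrow> t' \<le> s + n \<Longrightarrow> \<not> R (e t) (e t')"
  shows "map e [Suc s..<Suc (s + n)] \<in> ipaths R n U (e s)"
  using assms
proof (induction n arbitrary: s U)
  case (Suc n)
  have "map e [Suc (Suc s)..<Suc (Suc s + n)] \<in> ipaths R n {u \<in> U. \<not> R (e s) u} (e (Suc s))"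
    using Suc.prems by (intro Suc.IH) auto
  moreover have "[Suc s..<Suc (s + Suc n)] = Suc s # [Suc (Suc s)..<Suc (Suc s + n)]"
    by (subst upt_conv_Cons) auto
  ultimately show ?case
    using Suc.prems(1)[of "Suc s"] Suc.prems(2)[of s] by auto
qed simp

section \<open>Labelled induced cycles\<close>

definition cyc_adj :: "nat \<Rightarrow> nat \<Rightarrow> nat \<Rightarrow> bool" where
  "cyc_adj k i j \<longleftrightarrow> j = Suc i mod k \<or> i = Suc j mod k"

lemma cyc_adj_iff_cycle_graph:
  assumes "i < k" "j < k"
  shows "{i, j} \<in> edges (cycle_graph k) \<longleftrightarrow> cyc_adj k i j"
  using assms by (auto simp: cycle_graph_def cyc_adj_def doubleton_eq_iff)

section \<open>Dihedral symmetries of the cycle\<close>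

lemma eq_mod_iff_dvd:
  assumes "(j::nat) < k"
  shows "j = a mod k \<longleftrightarrow> int k dvd int j - int a"
proof -
  have "j = a mod k \<longleftrightarrow> j mod k = a mod k" using assms by simp
  also have "\<dots> \<longleftrightarrow> int j mod int k = int a mod int k"
    by (metis zmod_int of_nat_eq_iff)
  finally show ?thesis by (simp add: mod_eq_dvd_iff)
qed

text \<open>Over the integers, adjacency means that the difference is 1 or -1 modulo
  \<open>k\<close>, so symmetries can be checked by adding multiples of \<open>k\<close>.\<close>

lemma cyc_adj_iff_dvd:
  assumes "i < k" "j < k"
  shows "cyc_adj k i j \<longleftrightarrow> int k dvd int j - int i - 1 \<or> int k dvd int i - int j - 1"
  unfolding cyc_adj_def using assms by (simp add: eq_mod_iff_dvd algebra_simps)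

lemma mod_eq_nat_plus: "\<exists>q::int. int (a mod k) = int a - q * int k"
  by (metis minus_div_mult_eq_mod zmod_int)

lemma dvd_shift: "X = Y + r * d \<Longrightarrow> d dvd X \<longleftrightarrow> d dvd Y" for X Y r d :: int
  by (simp add: dvd_add_left_iff)

lemma cyc_adj_rotate:
  assumes "k > 0" "i < k" "j < k"
  shows "cyc_adj k ((a + i) mod k) ((a + j) mod k) \<longleftrightarrow> cyc_adj k i j"
proof -
  obtain p q :: int where "int ((a + i) mod k) = int (a + i) - p * int k"
      "int ((a + j) mod k) = int (a + j) - q * int k"
    using mod_eq_nat_plus by meson
  then have "int ((a + j) mod k) - int ((a + i) mod k) - 1 = int j - int i - 1 + (p - q) * int k"
    "int ((a + i) mod k) - int ((a + j) mod k) - 1 = int i - int j - 1 + (q - p) * int k"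
    by (simp_all add: algebra_simps)
  from this[THEN dvd_shift] show ?thesis
    using assms by (subst (1 2) cyc_adj_iff_dvd) auto
qed

text \<open>The map sending \<open>i\<close> to \<open>a - i\<close> modulo \<open>k\<close> negates
  differences, which exchanges the two disjuncts of \<open>cyc_adj_iff_dvd\<close>. Writing
  \<open>k - i\<close> avoids truncated subtraction.\<close>

lemma cyc_adj_reflect:
  assumes "k > 0" "i < k" "j < k"
  shows "cyc_adj k ((a + (k - i)) mod k) ((a + (k - j)) mod k) \<longleftrightarrow> cyc_adj k i j"
proof -
  obtain p q :: int where "int ((a + (k - i)) mod k) = int (a + (k - i)) - p * int k"
      "int ((a + (k - j)) mod k) = int (a + (k - j)) - q * int k"
    using mod_eq_nat_plus by meson
  then have "int ((a + (k - j)) mod k) - int ((a + (k - i)) mod k) - 1 = int i - int j - 1 + (p - q) * int k"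
    "int ((a + (k - i)) mod k) - int ((a + (k - j)) mod k) - 1 = int j - int i - 1 + (q - p) * int k"
    using assms by (simp_all add: algebra_simps of_nat_diff)
  from this[THEN dvd_shift] show ?thesis
    using assms by (subst (1 2) cyc_adj_iff_dvd) auto
qed

text \<open>Without vertex \<open>k - 1\<close> nothing wraps around, so a path remains.\<close>

lemma cyc_adj_path:
  assumes "s < k - 1" "s' < k - 1"
  shows "cyc_adj k s s' \<longleftrightarrow> s' = Suc s \<or> s = Suc s'"
  using assms by (auto simp: cyc_adj_def)

lemma mod_add_eq_iff:
  assumes "(i::nat) < k" "j < k"
  shows "(a + i) mod k = (a + j) mod k \<longleftrightarrow> i = j"
proof
  assume "(a + i) mod k = (a + j) mod k"
  then have "int k dvd int i - int j"
    by (metis add_diff_cancel_left mod_eq_dvd_iff of_nat_add zmod_int)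
  then show "i = j" using assms
    by (metis eq_mod_iff_dvd mod_less)
qed simp

section \<open>Embeddings of the cycle and induced copies\<close>

definition induced_cycles :: "'a graph \<Rightarrow> nat \<Rightarrow> (nat \<Rightarrow> 'a) set" where
  "induced_cycles G k = {f \<in> {..<k} \<rightarrow>\<^sub>E verts G. inj_on f {..<k} \<and>
     (\<forall>i<k. \<forall>j<k. {f i, f j} \<in> edges G \<longleftrightarrow> cyc_adj k i j)}"

lemma finite_induced_cycles: "finite (verts G) \<Longrightarrow> finite (induced_cycles G k)"
  unfolding induced_cycles_def by (rule finite_subset[OF _ finite_PiE[of "{..<k}" "\<lambda>_. verts G"]]) auto

text \<open>Precomposition with an automorphism of the cycle only relabels the same induced
  cycle.\<close>

lemma induced_cycles_comp:
  assumes f: "f \<in> induced_cycles G k" and \<sigma>: "\<And>i. i < k \<Longrightarrow> \<sigma> i < k" "inj_on \<sigma> {..<k}"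
    "\<And>i j. i < k \<Longrightarrow> j < k \<Longrightarrow> cyc_adj k (\<sigma> i) (\<sigma> j) \<longleftrightarrow> cyc_adj k i j"
  shows "restrict (f \<circ> \<sigma>) {..<k} \<in> induced_cycles G k"
    and "restrict (f \<circ> \<sigma>) {..<k} ` {..<k} = f ` {..<k}"
proof -
  have "\<sigma> ` {..<k} = {..<k}"
    using \<sigma> by (intro endo_inj_surj) auto
  then show "restrict (f \<circ> \<sigma>) {..<k} ` {..<k} = f ` {..<k}"
    using image_comp[of f \<sigma> "{..<k}"] by simp
  have "inj_on (f \<circ> \<sigma>) {..<k}"
    using f \<sigma> \<open>\<sigma> ` {..<k} = {..<k}\<close> by (intro comp_inj_on) (auto simp: induced_cycles_def)
  then show "restrict (f \<circ> \<sigma>) {..<k} \<in> induced_cycles G k"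
    using f \<sigma> by (auto simp: induced_cycles_def inj_on_def)
qed

text \<open>The composites of \<open>f\<close> with the \<open>2 * k\<close> elements of the dihedral group are distinct.\<close>

lemma card_induced_cycles_fibre:
  assumes k: "k \<ge> 3" and G: "finite (verts G)" and f: "f \<in> induced_cycles G k"
  shows "2 * k \<le> card {g \<in> induced_cycles G k. g ` {..<k} = f ` {..<k}}"
proof -
  \<comment> \<open>The flag \<open>b\<close> selects a rotation or a reflection; \<open>a\<close>
    is the image of 0 in both cases.\<close>
  define \<sigma> where "\<sigma> b a i = (if b then (a + i) mod k else (a + (k - i)) mod k)" for b :: bool and a i :: nat
  define F where "F = (\<lambda>(b, a). restrict (f \<circ> \<sigma> b a) {..<k})"
  have \<sigma>_less: "\<sigma> b a i < k" for b a i
    using k by (simp add: \<sigma>_def)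
  have inj_refl: "(a + (k - i)) mod k = (a + (k - j)) mod k \<longleftrightarrow> i = j" if "i < k" "j < k" for a i j
  proof -
    \<comment> \<open>At \<open>i = 0\<close> the summand \<open>k - i\<close> equals
      \<open>k\<close>, out of range for \<open>mod_add_eq_iff\<close>; moving 1 into the offset
      brings it below \<open>k\<close>.\<close>
    have "a + (k - i) = (a + 1) + (k - 1 - i)" "a + (k - j) = (a + 1) + (k - 1 - j)"
      using that by auto
    then show ?thesis
      using that mod_add_eq_iff[of "k - 1 - i" k "k - 1 - j" "a + 1"] by (simp only:) auto
  qed
  have \<sigma>_inj: "inj_on (\<sigma> b a) {..<k}" for b a
    by (cases b; rule inj_onI)
      (simp_all only: \<sigma>_def if_True if_False lessThan_iff mod_add_eq_iff inj_refl)
  have \<sigma>_adj: "cyc_adj k (\<sigma> b a i) (\<sigma> b a j) \<longleftrightarrow> cyc_adj k i j" if "i < k" "j < k" for b a i j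
    using that k cyc_adj_rotate[of k i j a] cyc_adj_reflect[of k i j a] by (simp add: \<sigma>_def)
  have "inj_on F (UNIV \<times> {..<k})"
  proof (rule inj_onI)
    fix z z' assume z: "z \<in> UNIV \<times> {..<k}" "z' \<in> UNIV \<times> {..<k}" "F z = F z'"
    obtain b a b' a' where zz: "z = (b, a)" "z' = (b', a')"
      by fastforce
    from z have a: "a \<in> {..<k}" "a' \<in> {..<k}" and eq: "F (b, a) = F (b', a')"
      by (simp_all add: zz)
    have "f (\<sigma> b a i) = f (\<sigma> b' a' i)" if "i < k" for i
      using that fun_cong[OF eq, of i] by (simp add: F_def)
    then have *: "\<sigma> b a i = \<sigma> b' a' i" if "i < k" for i
      using that f \<sigma>_less by (auto simp: induced_cycles_def inj_on_def)
    \<comment> \<open>The value at 0 recovers \<open>a\<close>. The value at 1 then tells rotation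
      from reflection, because 1 and -1 differ modulo \<open>k \<ge> 3\<close>.\<close>
    have "\<sigma> b a 0 = a" "\<sigma> b' a' 0 = a'"
      using a by (auto simp: \<sigma>_def)
    with *[of 0] k have aa: "a = a'" by simp
    have "\<not> (a + 1) mod k = (a + (k - 1)) mod k"
      using mod_add_eq_iff[of 1 k "k - 1" a] k by auto
    with *[of 1] k aa show "z = z'"
      by (cases b; cases b') (auto simp: \<sigma>_def zz)
  qed
  then have "card (F ` (UNIV \<times> {..<k})) = 2 * k"
    by (simp add: card_image card_cartesian_product)
  moreover have "F z \<in> induced_cycles G k \<and> F z ` {..<k} = f ` {..<k}" for z
    unfolding F_def case_prod_beta
    using induced_cycles_comp[OF f \<sigma>_less \<sigma>_inj \<sigma>_adj] by blast
  then have "F ` (UNIV \<times> {..<k}) \<subseteq> {g \<in> induced_cycles G k. g ` {..<k} = f ` {..<k}}"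
    by blast
  moreover have "finite {g \<in> induced_cycles G k. g ` {..<k} = f ` {..<k}}"
    using finite_induced_cycles[OF G] by simp
  ultimately show ?thesis
    by (metis card_mono)
qed

text \<open>Isomorphisms from \<open>induced G S\<close> to the cycle and labelled induced cycles
  with image \<open>S\<close> are inverse to each other.\<close>

lemma graph_iso_cycle_iff:
  assumes "S \<subseteq> verts G"
  shows "graph_iso (induced G S) (cycle_graph k) \<longleftrightarrow> S \<in> (\<lambda>f. f ` {..<k}) ` induced_cycles G k"
proof
  assume "graph_iso (induced G S) (cycle_graph k)"
  then obtain h where h: "bij_betw h S {..<k}"
    "\<And>u v. u \<in> S \<Longrightarrow> v \<in> S \<Longrightarrow> {u, v} \<in> edges G \<longleftrightarrow> {h u, h v} \<in> edges (cycle_graph k)"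
    by (auto simp: graph_iso_def induced_def cycle_graph_def)
  define f where "f = restrict (inv_into S h) {..<k}"
  have b: "bij_betw (inv_into S h) {..<k} S"
    using h(1) by (rule bij_betw_inv_into)
  then have im: "f ` {..<k} = S" by (auto simp: f_def bij_betw_def)
  have "inj_on f {..<k}" using b by (auto simp: f_def bij_betw_def inj_on_def)
  moreover have "f i \<in> S" "h (f i) = i" if "i < k" for i
    using that im h(1) by (auto simp: f_def bij_betw_def f_inv_into_f)
  then have "{f i, f j} \<in> edges G \<longleftrightarrow> cyc_adj k i j" if "i < k" "j < k" for i j
    using that h(2)[of "f i" "f j"] by (simp add: cyc_adj_iff_cycle_graph)
  ultimately have "f \<in> induced_cycles G k"
    using im assms by (auto simp: induced_cycles_def f_def)
  with im show "S \<in> (\<lambda>f. f ` {..<k}) ` induced_cycles G k" by blast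
next
  assume "S \<in> (\<lambda>f. f ` {..<k}) ` induced_cycles G k"
  then obtain f where f: "f \<in> induced_cycles G k" "S = f ` {..<k}" by blast
  then have b: "bij_betw f {..<k} S" by (auto simp: induced_cycles_def bij_betw_def)
  let ?h = "inv_into {..<k} f"
  have "{u, v} \<in> edges G \<longleftrightarrow> {?h u, ?h v} \<in> edges (cycle_graph k)" if "u \<in> S" "v \<in> S" for u v
  proof -
    have "?h u < k" "?h v < k" "f (?h u) = u" "f (?h v) = v"
      using that inv_into_into[of _ f "{..<k}"] unfolding f(2) by (auto simp: f_inv_into_f)
    then show ?thesis
      using f(1) cyc_adj_iff_cycle_graph[of "?h u" k "?h v"] unfolding induced_cycles_def by fastforce
  qed
  then show "graph_iso (induced G S) (cycle_graph k)"
    using bij_betw_inv_into[OF b]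
    by (auto simp: graph_iso_def induced_def cycle_graph_def intro!: exI[of _ ?h])
qed

lemma induced_cycles_subset: "f \<in> induced_cycles G k \<Longrightarrow> f ` {..<k} \<subseteq> verts G"
  by (auto simp: induced_cycles_def)

lemma induced_copies_eq:
  "induced_copies G (cycle_graph k) = card ((\<lambda>f. f ` {..<k}) ` induced_cycles G k)"
proof -
  have "{S. S \<subseteq> verts G \<and> graph_iso (induced G S) (cycle_graph k)} = (\<lambda>f. f ` {..<k}) ` induced_cycles G k"
    using graph_iso_cycle_iff[of _ G k] induced_cycles_subset[of _ G k] by blast
  then show ?thesis by (simp add: induced_copies_def)
qed

text \<open>Grouping the labelled cycles by vertex set gives classes of at least
  \<open>2 * k\<close> members each.\<close>

lemma induced_copies_le:
  assumes k: "k \<ge> 3" and G: "finite (verts G)"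
  shows "2 * k * induced_copies G (cycle_graph k) \<le> card (induced_cycles G k)"
proof -
  let ?A = "induced_cycles G k" and ?im = "\<lambda>f. f ` {..<k}"
  note fin = finite_induced_cycles[OF G, of k]
  have "2 * k * card (?im ` ?A) = (\<Sum>S\<in>?im ` ?A. 2 * k)" by simp
  also have "\<dots> \<le> (\<Sum>S\<in>?im ` ?A. card {f \<in> ?A. ?im f = S})"
    using card_induced_cycles_fibre[OF k G] by (intro sum_mono) auto
  also have "\<dots> = card (\<Union>S\<in>?im ` ?A. {f \<in> ?A. ?im f = S})"
    using fin by (intro card_UN_disjoint[symmetric]) auto
  also have "(\<Union>S\<in>?im ` ?A. {f \<in> ?A. ?im f = S}) = ?A" by auto
  finally show ?thesis by (simp add: induced_copies_eq)
qed

section \<open>The upper bound\<close>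

text \<open>
  If \<open>a\<close> and \<open>b\<close> traversed a matching edge in opposite directions, then the edge of one path
  leading to a neighbouring matching edge would be a chord of the other path.
\<close>

lemma path_determined_by_matching:
  assumes l: "l \<ge> 2"
    and a: "\<And>s s'. s < 2 * l \<Longrightarrow> s' < 2 * l \<Longrightarrow> {a s, a s'} \<in> E \<longleftrightarrow> s' = Suc s \<or> s = Suc s'"
    and b: "\<And>s s'. s < 2 * l \<Longrightarrow> s' < 2 * l \<Longrightarrow> {b s, b s'} \<in> E \<longleftrightarrow> s' = Suc s \<or> s = Suc s'"
    and eq: "\<And>t. t < l \<Longrightarrow> {a (2 * t), a (Suc (2 * t))} = {b (2 * t), b (Suc (2 * t))}"
    and s: "s < 2 * l"
  shows "a s = b s"
proof -
  have "a (2 * t) = b (2 * t) \<and> a (Suc (2 * t)) = b (Suc (2 * t))" if t: "t < l" for t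
  proof (rule ccontr)
    assume "\<not> ?thesis"
    with eq[OF t] have swap: "a (2 * t) = b (Suc (2 * t))" "a (Suc (2 * t)) = b (2 * t)"
      by (auto simp: doubleton_eq_iff)
    show False
    proof (cases "Suc t < l")
      case True
      have "{a (Suc (2 * t)), a (2 * Suc t)} \<in> E"
        using True by (subst a) auto
      moreover have "a (2 * Suc t) = b (2 * Suc t) \<or> a (2 * Suc t) = b (Suc (2 * Suc t))"
        using eq[OF True] by (auto simp: doubleton_eq_iff)
      ultimately have "{b (2 * t), b (2 * Suc t)} \<in> E \<or> {b (2 * t), b (Suc (2 * Suc t))} \<in> E"
        by (auto simp: swap)
      then show False
        using True by (subst (asm) (1 2) b) auto
    next
      \<comment> \<open>The last matching edge has no successor, so its predecessor is used; it
        exists because \<open>l \<ge> 2\<close>.\<close>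
      case False
      define r where "r = t - 1"
      have r: "t = Suc r" "r < l"
        using False t l by (auto simp: r_def)
      have "{a (2 * t), a (Suc (2 * r))} \<in> E"
        using r t by (subst a) auto
      moreover have "a (Suc (2 * r)) = b (2 * r) \<or> a (Suc (2 * r)) = b (Suc (2 * r))"
        using eq[OF r(2)] by (auto simp: doubleton_eq_iff)
      ultimately have "{b (Suc (2 * t)), b (2 * r)} \<in> E \<or> {b (Suc (2 * t)), b (Suc (2 * r))} \<in> E"
        by (auto simp: swap)
      then show False
        using r t by (subst (asm) (1 2) b) auto
    qed
  qed
  from this[of "s div 2"] s show ?thesis
    by (cases "even s") (auto elim!: evenE oddE)
qed

text \<open>The code \<open>\<phi> f\<close> lists the matching edges of the path left after
  forgetting \<open>i\<close>, and \<open>path_determined_by_matching\<close> makes it faithful. Any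
  edge may come first; \<open>card_ipaths_le\<close> bounds the \<open>l - 1\<close>
  continuations.\<close>

lemma card_cycle_projection_le:
  assumes l: "l \<ge> 2" and G: "finite (edges G)" and i: "i < 2 * l + 1"
    and fin: "finite (verts G)"
  shows "real (card ((\<lambda>f. restrict f ({..<2 * l + 1} - {i})) ` induced_cycles G (2 * l + 1)))
         \<le> real (card (edges G)) * (real (card (edges G)) / real (l - 1)) ^ (l - 1)"
proof -
  define k where "k = 2 * l + 1"
  define A where "A = induced_cycles G k"
  define E where "E = edges G"
  define R where "R d e \<longleftrightarrow> (\<exists>u\<in>d. \<exists>v\<in>e. {u, v} \<in> E)" for d e :: "'a set"
  \<comment> \<open>Reading starts just after the forgotten vertex \<open>i\<close>, so positions
    below \<open>2 * l\<close> never meet it.\<close>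
  define a where "a f t = f ((i + 1 + t) mod k)" for f :: "nat \<Rightarrow> 'a" and t
  define e where "e f t = {a f (2 * t), a f (Suc (2 * t))}" for f t
  define \<phi> where "\<phi> f = map (e f) [0..<l]" for f
  have adj: "{a f s, a f s'} \<in> E \<longleftrightarrow> s' = Suc s \<or> s = Suc s'"
    if "f \<in> A" "s < 2 * l" "s' < 2 * l" for f s s'
  proof -
    have "{a f s, a f s'} \<in> E \<longleftrightarrow> cyc_adj k ((i + 1 + s) mod k) ((i + 1 + s') mod k)"
      using that(1) by (simp add: A_def induced_cycles_def a_def E_def k_def)
    also have "\<dots> \<longleftrightarrow> cyc_adj k s s'"
      using that by (intro cyc_adj_rotate) (auto simp: k_def)
    finally show ?thesis
      using that by (simp add: cyc_adj_path k_def)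
  qed
  \<comment> \<open>Matching edges \<open>t < t'\<close> can only be joined by the path edge from
    position \<open>2 * t + 1\<close> to \<open>2 * t + 2\<close>, which forces
    \<open>t' = Suc t\<close>.\<close>
  have R_iff: "R (e f t) (e f t') \<longleftrightarrow> t' = Suc t"
    if "f \<in> A" "t < t'" "t' < l" for f t t'
    using that by (auto simp: R_def e_def adj)
  have eE: "e f t \<in> E" if "f \<in> A" "t < l" for f t
    using that by (simp add: e_def adj)
  have "\<phi> f \<in> (\<Union>x\<in>E. (#) x ` ipaths R (l - 1) E x)" if f: "f \<in> A" for f
  proof -
    have "map (e f) [Suc 0..<Suc (0 + (l - 1))] \<in> ipaths R (l - 1) E (e f 0)"
      using l by (intro map_upt_in_ipaths) (auto simp: eE f R_iff)
    moreover have "[0..<l] = 0 # [Suc 0..<Suc (0 + (l - 1))]"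
      using l by (subst upt_conv_Cons) auto
    ultimately show ?thesis
      using eE[OF f, of 0] l by (auto simp: \<phi>_def)
  qed
  then have \<phi>_sub: "\<phi> ` A \<subseteq> (\<Union>x\<in>E. (#) x ` ipaths R (l - 1) E x)"
    by blast
  have finE: "finite E"
    using G by (simp add: E_def)
  have "card ((\<lambda>f. restrict f ({..<k} - {i})) ` A) \<le> card (\<phi> ` A)"
  proof (rule card_image_le_if_determined)
    show "finite A"
      unfolding A_def by (rule finite_induced_cycles[OF fin])
    fix f g assume fg: "f \<in> A" "g \<in> A" "\<phi> f = \<phi> g"
    have "e f t = e g t" if "t < l" for t
      using fg(3) that by (simp add: \<phi>_def)
    then have *: "a f s = a g s" if "s < 2 * l" for s
      using path_determined_by_matching[OF l adj[OF fg(1)] adj[OF fg(2)] _ that]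
      by (simp add: e_def)
    have "f j = g j" if j: "j < k" "j \<noteq> i" for j
    proof -
      \<comment> \<open>The position at which the cyclic reading from \<open>i + 1\<close> reaches
        \<open>j\<close>.\<close>
      define s where "s = (if i < j then j - i - 1 else j + k - i - 1)"
      have "s < 2 * l" "i + 1 + s = j \<or> i + 1 + s = j + k"
        using j i by (auto simp: s_def k_def)
      then have "s < 2 * l" "(i + 1 + s) mod k = j"
        using j by auto
      with *[of s] show ?thesis by (simp add: a_def)
    qed
    then show "restrict f ({..<k} - {i}) = restrict g ({..<k} - {i})"
      by (simp add: restrict_eq_iff)
  qed
  also have "\<dots> \<le> card (\<Union>x\<in>E. (#) x ` ipaths R (l - 1) E x)"
    using finE by (intro card_mono \<phi>_sub) (simp add: finite_ipaths)
  also have "\<dots> \<le> (\<Sum>x\<in>E. card ((#) x ` ipaths R (l - 1) E x))"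
    using finE by (rule card_UN_le)
  also have "\<dots> = (\<Sum>x\<in>E. card (ipaths R (l - 1) E x))"
    by (intro sum.cong card_image) auto
  finally have "real (card ((\<lambda>f. restrict f ({..<k} - {i})) ` A))
      \<le> (\<Sum>x\<in>E. real (card (ipaths R (l - 1) E x)))"
    by (metis of_nat_le_iff of_nat_sum)
  also have "\<dots> \<le> (\<Sum>x\<in>E. (real (card E) / real (l - 1)) ^ (l - 1))"
    using finE by (intro sum_mono card_ipaths_le)
  finally show ?thesis
    by (simp add: A_def E_def k_def)
qed

text \<open>Loomis--Whitney with the same bound for all \<open>2 * l + 1\<close> projections. The
  empty case is separate because \<open>loomis_whitney\<close> assumes a nonempty set.\<close>

lemma card_induced_cycles_power_le:
  assumes l: "l \<ge> 2" and G: "simple_graph G"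
  shows "real (card (induced_cycles G (2 * l + 1))) ^ (2 * l)
         \<le> (real (card (edges G)) * (real (card (edges G)) / real (l - 1)) ^ (l - 1)) ^ (2 * l + 1)"
    (is "real (card ?A) ^ _ \<le> ?P ^ _")
proof (cases "?A = {}")
  case True
  then have "real (card ?A) ^ (2 * l) = 0" using l by simp
  moreover have "0 \<le> ?P ^ (2 * l + 1)" by (intro zero_le_power mult_nonneg_nonneg) auto
  ultimately show ?thesis by linarith
next
  case False
  have fin: "finite (verts G)" and "edges G \<subseteq> Pow (verts G)"
    using G by (auto simp: simple_graph_def)
  then have finE: "finite (edges G)"
    by (meson finite_Pow_iff finite_subset)
  let ?I = "{..<2 * l + 1}"
  have "real (card ?A) ^ (card ?I - 1)
      \<le> (\<Prod>i\<in>?I. real (card ((\<lambda>f. restrict f (?I - {i})) ` ?A)))"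
  proof (rule loomis_whitney)
    show "?A \<subseteq> extensional ?I"
      by (auto simp: induced_cycles_def PiE_def)
  qed (use False finite_induced_cycles[OF fin] in auto)
  also have "\<dots> \<le> (\<Prod>i\<in>?I. ?P)"
    by (intro prod_mono conjI card_cycle_projection_le[OF l finE _ fin]) auto
  finally show ?thesis by simp
qed

text \<open>Take the \<open>2 * l\<close>-th root of the preceding bound, then divide by the
  \<open>2 * k\<close> labellings of each copy.\<close>

lemma induced_copies_odd_cycle_le:
  assumes l: "l \<ge> 2" and G: "simple_graph G" and m: "card (edges G) = m" "m \<ge> 1"
  shows "real (induced_copies G (cycle_graph (2 * l + 1)))
         \<le> real (2 * l + 1) powr (real l - 1 / 2)
           / (2 * (real l - 1) powr ((real l - 1) * real (2 * l + 1) / (2 * real l)))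
           * (real m / real (2 * l + 1)) powr (real (2 * l + 1) / 2)"
proof -
  define k where "k = 2 * l + 1"
  define N where "N = real (card (induced_cycles G k))"
  define P where "P = real m * (real m / real (l - 1)) ^ (l - 1)"
  define D where "D = (real l - 1) powr ((real l - 1) * real k / (2 * real l))"
  have l1: "real (l - 1) = real l - 1" "real l - 1 > 0"
    using l by (auto simp: of_nat_diff)
  have kpos: "real k > 0" by (simp add: k_def)
  have D: "D > 0" using l1 by (simp add: D_def)
  have P: "P = real m powr real l / (real l - 1) powr (real l - 1)"
  proof -
    have "real m ^ Suc (l - 1) = real m powr real l"
      using m l by (subst powr_realpow[symmetric]) auto
    moreover have "real (l - 1) ^ (l - 1) = (real l - 1) powr (real l - 1)"
      using l1 by (metis powr_realpow)
    ultimately show ?thesis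
      by (simp add: P_def power_divide)
  qed
  have Ppos: "P > 0"
    using m l1 by (simp add: P)
  have "N ^ (2 * l) \<le> P ^ k"
    using card_induced_cycles_power_le[OF l G] unfolding N_def P_def k_def m(1) .
  then have "(N ^ (2 * l)) powr (1 / real (2 * l)) \<le> (P ^ k) powr (1 / real (2 * l))"
    by (intro powr_mono2) (auto simp: N_def)
  moreover have "(N ^ (2 * l)) powr (1 / real (2 * l)) = N"
    using l by (subst root_powr_inverse[symmetric]) (auto simp: real_root_power_cancel N_def)
  moreover have "(P ^ k) powr (1 / real (2 * l)) = P powr (real k / (2 * real l))"
    using Ppos by (simp add: powr_realpow[symmetric] powr_powr)
  moreover have "P powr (real k / (2 * real l)) = real m powr (real k / 2) / D"
    using l l1 by (simp add: P powr_divide powr_powr D_def)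
  ultimately have N: "N \<le> real m powr (real k / 2) / D"
    by simp
  have "finite (verts G)"
    using G by (simp add: simple_graph_def)
  then have "2 * k * induced_copies G (cycle_graph k) \<le> card (induced_cycles G k)"
    using l by (intro induced_copies_le) (auto simp: k_def)
  then have "real (2 * k * induced_copies G (cycle_graph k)) \<le> N"
    unfolding N_def by (subst of_nat_le_iff)
  with N have "real (2 * k) * real (induced_copies G (cycle_graph k)) \<le> real m powr (real k / 2) / D"
    by simp
  then have "real (induced_copies G (cycle_graph k)) \<le> real m powr (real k / 2) / D / (2 * real k)"
    using kpos by (subst pos_le_divide_eq) (simp_all only: ac_simps of_nat_mult of_nat_numeral mult_pos_pos zero_less_numeral)
  \<comment> \<open>Since \<open>k / 2 = (l - 1 / 2) + 1\<close>, one factor \<open>k\<close> of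
    \<open>k powr (k / 2)\<close> cancels against the divisor \<open>2 * k\<close>.\<close>
  also have "\<dots> = real k powr (real l - 1 / 2) / (2 * D) * (real m / real k) powr (real k / 2)"
  proof -
    have "real k powr (real k / 2) = real k powr (real l - 1 / 2) * real k"
    proof -
      have "real k / 2 = (real l - 1 / 2) + 1" by (simp add: k_def field_simps)
      then show ?thesis using kpos by (simp only: powr_add) simp
    qed
    then show ?thesis
      using kpos D by (simp add: powr_divide field_simps)
  qed
  finally show ?thesis
    by (simp only: k_def D_def)
qed

section \<open>The lower bound\<close>

text \<open>The bound \<open>B\<close> makes the set of counts finite and the graph \<open>G\<close>
  makes it nonempty, so \<open>Max\<close> is a genuine maximum.\<close>

lemma rho_between:
  fixes G :: "nat graph"
  assumes B: "\<And>G :: nat graph. simple_graph G \<Longrightarrow> card (edges G) = m \<Longrightarrow> real (induced_copies G H) \<le> B"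
    and G: "simple_graph G" "card (edges G) = m"
  shows "induced_copies G H \<le> rho H m" and "real (rho H m) \<le> B"
proof -
  let ?S = "{induced_copies G H | G :: nat graph. simple_graph G \<and> card (edges G) = m}"
  have "?S \<subseteq> {..nat \<lfloor>B\<rfloor>}"
    using B by (auto simp: le_nat_floor)
  then have fin: "finite ?S"
    by (rule finite_subset) simp
  show "induced_copies G H \<le> rho H m"
    unfolding rho_def using G by (intro Max_ge[OF fin]) blast
  have "rho H m \<in> ?S"
    unfolding rho_def using G by (intro Max_in[OF fin]) blast
  then show "real (rho H m) \<le> B"
    using B by auto
qed

text \<open>
  The blow-up of the cycle with parts of size \<open>t\<close> (vertex \<open>x < t * k\<close> lies in part \<open>x mod k\<close>),
  together with a star that uses up the remaining edges.
\<close>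

lemma ex_graph_many_induced_cycles:
  assumes k: "k \<ge> 3" and m: "k * t ^ 2 \<le> m"
  shows "\<exists>G :: nat graph. simple_graph G \<and> card (edges G) = m \<and> t ^ k \<le> induced_copies G (cycle_graph k)"
proof -
  \<comment> \<open>The index \<open>i\<close> names a part, \<open>p\<close> a vertex of it, and
    \<open>q\<close> a vertex of the cyclically next part.\<close>
  define E0 where "E0 = (\<lambda>(i, p, q). {p * k + i, q * k + Suc i mod k}) ` ({..<k} \<times> {..<t} \<times> {..<t})"
  define c where "c = t * k"
  \<comment> \<open>Whatever \<open>E0\<close> leaves over is filled by the star, so only an upper
    bound on \<open>card E0\<close> has to be proved.\<close>
  define r where "r = m - card E0"
  define D where "D = (\<lambda>j. {c, Suc (c + j)}) ` {..<r}"
  define G where "G = ({..c + r}, E0 \<union> D)"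
  have less_c: "p * k + i < c" if "p < t" "i < k" for p i
  proof -
    have "p * k + i < Suc p * k" using that by simp
    also have "\<dots> \<le> c" unfolding c_def using that by (intro mult_le_mono1) auto
    finally show ?thesis .
  qed
  have E0_less: "x < c" if "e \<in> E0" "x \<in> e" for e x
    using that less_c k by (auto simp: E0_def)
  have E0_card: "card e = 2" if "e \<in> E0" for e
  proof -
    from that obtain i p q where e: "e = {p * k + i, q * k + Suc i mod k}" "i < k"
      by (auto simp: E0_def)
    have "(p * k + i) mod k \<noteq> (q * k + Suc i mod k) mod k"
      using e(2) k by (auto simp: mod_Suc)
    then have "p * k + i \<noteq> q * k + Suc i mod k" by metis
    with e show ?thesis by simp
  qed
  have fin: "finite E0" "finite D"
    by (auto simp: E0_def D_def)
  have "card E0 \<le> card ({..<k} \<times> {..<t} \<times> {..<t})"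
    unfolding E0_def by (rule card_image_le) auto
  also have "\<dots> \<le> m"
    using m by (simp add: power2_eq_square)
  finally have "card E0 \<le> m" .
  moreover have "card D = r"
    unfolding D_def by (subst card_image) (auto simp: inj_on_def doubleton_eq_iff)
  moreover have "E0 \<inter> D = {}"
    using E0_less by (fastforce simp: D_def)
  ultimately have "card (E0 \<union> D) = m"
    using fin by (simp add: card_Un_disjoint r_def)
  moreover have "simple_graph G"
  proof -
    have "e \<subseteq> {..c + r}" if "e \<in> E0" for e
      using E0_less[OF that] by fastforce
    then show ?thesis
      using E0_card by (auto simp: simple_graph_def G_def D_def)
  qed
  moreover have "t ^ k \<le> induced_copies G (cycle_graph k)"
  proof -
    \<comment> \<open>Every star edge has an endpoint above \<open>c\<close>, so below
      \<open>c\<close> adjacency depends on the parts alone.\<close>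
    have adj: "{x, y} \<in> edges G \<longleftrightarrow> cyc_adj k (x mod k) (y mod k)" if "x < c" "y < c" for x y
    proof
      assume "{x, y} \<in> edges G"
      moreover have "{x, y} \<notin> D" using that by (auto simp: D_def doubleton_eq_iff)
      ultimately have "{x, y} \<in> E0" by (auto simp: G_def)
      then show "cyc_adj k (x mod k) (y mod k)"
        by (auto simp: E0_def doubleton_eq_iff cyc_adj_def)
    next
      have *: "{x, y} \<in> E0" if "x < c" "y < c" "y mod k = Suc (x mod k) mod k" for x y
      proof -
        have "x = x div k * k + x mod k" "y = y div k * k + Suc (x mod k) mod k"
          by (simp_all flip: that(3))
        moreover have "x div k < t" "y div k < t"
          using that by (auto simp: c_def less_mult_imp_div_less)
        moreover have "x mod k < k" using k by simp
        ultimately show ?thesis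
          unfolding E0_def by (intro image_eqI[where x = "(x mod k, x div k, y div k)"]) auto
      qed
      assume "cyc_adj k (x mod k) (y mod k)"
      then show "{x, y} \<in> edges G"
        using *[of x y] *[of y x] that by (auto simp: cyc_adj_def G_def insert_commute)
    qed
    let ?T = "{..<k} \<rightarrow>\<^sub>E {..<t}"
    \<comment> \<open>The function \<open>q\<close> picks one vertex from each part. The residue
      modulo \<open>k\<close> of a vertex reveals its part, so the transversal determines
      \<open>q\<close>.\<close>
    define F where "F q = restrict (\<lambda>i. q i * k + i) {..<k}" for q
    have F_cycle: "F q \<in> induced_cycles G k" if "q \<in> ?T" for q
    proof -
      have lt: "q i * k + i < c" if "i < k" for i
        using \<open>q \<in> ?T\<close> that by (intro less_c) auto
      have "i = j" if "i < k" "j < k" "q i * k + i = q j * k + j" for i j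
        using that by (metis mod_less mod_mult_self3)
      then show ?thesis
        using lt by (auto simp: induced_cycles_def F_def inj_on_def adj)
          (auto simp: G_def less_imp_le intro: trans_le_add1)
    qed
    have "inj_on (\<lambda>q. F q ` {..<k}) ?T"
    proof (rule inj_onI)
      fix q q' assume q: "q \<in> ?T" "q' \<in> ?T" and eq: "F q ` {..<k} = F q' ` {..<k}"
      have "q i = q' i" if i: "i < k" for i
      proof -
        have "q i * k + i \<in> F q' ` {..<k}"
          using i eq by (auto simp: F_def)
        then obtain j where j: "j < k" "q i * k + i = q' j * k + j"
          by (auto simp: F_def)
        then have "i = j"
          using i by (metis mod_less mod_mult_self3)
        then show ?thesis using j k by simp
      qed
      then show "q = q'"
        using q by (intro PiE_ext[of q]) auto
    qed
    then have "card ((\<lambda>q. F q ` {..<k}) ` ?T) = t ^ k"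
      by (simp add: card_image card_PiE)
    moreover have "(\<lambda>q. F q ` {..<k}) ` ?T \<subseteq> (\<lambda>f. f ` {..<k}) ` induced_cycles G k"
      using F_cycle by blast
    moreover have "finite (induced_cycles G k)"
      by (rule finite_induced_cycles) (simp add: G_def)
    ultimately show ?thesis
      unfolding induced_copies_eq by (metis card_mono finite_imageI)
  qed
  ultimately show ?thesis
    by (intro exI[of _ G]) (simp add: G_def)
qed

section \<open>Asymptotics and the final assembly\<close>

text \<open>Rounding down loses at most 1, so for \<open>m > 0\<close> the ratio lies between
  \<open>1 - sqrt (k / m)\<close> and 1.\<close>

lemma floor_sqrt_ratio_tendsto:
  assumes "k > 0"
  shows "(\<lambda>m. real_of_int \<lfloor>sqrt (real m / real k)\<rfloor> / sqrt (real m / real k)) \<longlonglongrightarrow> 1"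
proof (rule real_tendsto_sandwich)
  have "(\<lambda>m. 1 - sqrt (real k * (1 / real m))) \<longlonglongrightarrow> 1"
    by (auto intro!: tendsto_eq_intros lim_1_over_n)
  then show "(\<lambda>m. 1 - sqrt (real k / real m)) \<longlonglongrightarrow> 1"
    by simp
  show "(\<lambda>m. 1 :: real) \<longlonglongrightarrow> 1" by simp
  show "\<forall>\<^sub>F m in sequentially.
      1 - sqrt (real k / real m) \<le> real_of_int \<lfloor>sqrt (real m / real k)\<rfloor> / sqrt (real m / real k)"
    using eventually_gt_at_top[of 0]
  proof eventually_elim
    case (elim m)
    have s: "sqrt (real m / real k) > 0" using elim assms by simp
    have "1 - sqrt (real k / real m) = (sqrt (real m / real k) - 1) / sqrt (real m / real k)"
      using elim assms by (simp add: real_sqrt_divide field_simps)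
    also have "\<dots> \<le> real_of_int \<lfloor>sqrt (real m / real k)\<rfloor> / sqrt (real m / real k)"
      using s by (intro divide_right_mono) linarith+
    finally show ?case .
  qed
  show "\<forall>\<^sub>F m in sequentially. real_of_int \<lfloor>sqrt (real m / real k)\<rfloor> / sqrt (real m / real k) \<le> 1"
    using eventually_gt_at_top[of 0]
    by eventually_elim (use assms in \<open>auto simp: divide_le_eq_1\<close>)
qed

theorem theorem1p7:
  fixes l :: nat
  assumes "l \<ge> 2"
  shows "(\<exists>\<epsilon> :: nat \<Rightarrow> real. \<epsilon> \<longlonglongrightarrow> 0 \<and>
            (\<forall>m\<ge>1. (1 + \<epsilon> m) * (real m / real (2 * l + 1)) powr (real (2 * l + 1) / 2)
                    \<le> real (rho (cycle_graph (2 * l + 1)) m))) \<and>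
         (\<forall>m\<ge>1. real (rho (cycle_graph (2 * l + 1)) m)
                 \<le> real (2 * l + 1) powr (real l - 1 / 2)
                   / (2 * (real l - 1) powr ((real l - 1) * real (2 * l + 1) / (2 * real l)))
                   * (real m / real (2 * l + 1)) powr (real (2 * l + 1) / 2))"
    (is "?lower \<and> (\<forall>m\<ge>1. _ \<le> ?B m)")
proof
  define k where "k = 2 * l + 1"
  define s where "s m = sqrt (real m / real k)" for m
  \<comment> \<open>The largest part size for which the blow-up has at most \<open>m\<close>
    edges.\<close>
  define t where "t m = nat \<lfloor>s m\<rfloor>" for m
  have k: "k \<ge> 3" using assms by (simp add: k_def)
  have t: "real (t m) = real_of_int \<lfloor>s m\<rfloor>" for m
    by (simp add: t_def s_def)
  have "k * t m ^ 2 \<le> m" for m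
  proof -
    have "real (t m) ^ 2 \<le> s m ^ 2"
      unfolding t by (intro power_mono) (auto simp: s_def)
    also have "\<dots> = real m / real k"
      by (simp add: s_def)
    finally have "real (k * t m ^ 2) \<le> real m"
      using k by (simp add: field_simps)
    then show ?thesis by (simp only: of_nat_le_iff)
  qed
  then have "\<forall>m. \<exists>G :: nat graph. simple_graph G \<and> card (edges G) = m \<and>
      t m ^ k \<le> induced_copies G (cycle_graph k)"
    using ex_graph_many_induced_cycles[OF k] by blast
  from choice[OF this] obtain G :: "nat \<Rightarrow> nat graph" where
    G: "simple_graph (G m)" "card (edges (G m)) = m"
      "t m ^ k \<le> induced_copies (G m) (cycle_graph k)" for m
    by blast
  have le: "real (induced_copies H (cycle_graph k)) \<le> ?B m"
    if "m \<ge> 1" "simple_graph H" "card (edges H) = m" for m and H :: "nat graph"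
    using induced_copies_odd_cycle_le[OF assms that(2,3,1)] by (simp only: k_def)
  have rho: "induced_copies (G m) (cycle_graph k) \<le> rho (cycle_graph k) m"
    "real (rho (cycle_graph k) m) \<le> ?B m" if "m \<ge> 1" for m
    using rho_between[where H = "cycle_graph k" and B = "?B m" and G = "G m" and m = m]
      le[OF that] G by blast+
  then show "\<forall>m\<ge>1. real (rho (cycle_graph (2 * l + 1)) m) \<le> ?B m"
    by (simp only: k_def) blast
  \<comment> \<open>Chosen so that for \<open>m \<ge> 1\<close> the left side of the lower bound is
    exactly \<open>t m ^ k\<close>.\<close>
  define \<epsilon> where "\<epsilon> m = (real_of_int \<lfloor>s m\<rfloor> / s m) ^ k - 1" for m
  have "\<epsilon> \<longlonglongrightarrow> 1 ^ k - 1"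
    unfolding \<epsilon>_def s_def using k by (intro tendsto_intros floor_sqrt_ratio_tendsto) auto
  then have "\<epsilon> \<longlonglongrightarrow> 0" by simp
  moreover have "(1 + \<epsilon> m) * (real m / real k) powr (real k / 2) \<le> real (rho (cycle_graph k) m)"
    if m: "m \<ge> 1" for m
  proof -
    have s: "s m > 0" using m k by (simp add: s_def)
    have "(real m / real k) powr (real k / 2) = s m powr real k"
      unfolding s_def by (simp add: powr_half_sqrt[symmetric] powr_powr)
    then have "(1 + \<epsilon> m) * (real m / real k) powr (real k / 2) = real (t m ^ k)"
      using s by (simp add: \<epsilon>_def powr_realpow power_divide t)
    also have "\<dots> \<le> real (rho (cycle_graph k) m)"
      using order_trans[OF G(3) rho(1)[OF m]] by (simp only: of_nat_le_iff)
    finally show ?thesis .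
  qed
  ultimately show ?lower
    unfolding k_def by blast
qed

end
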